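(* Let $(X,\sigma)$ be a Deaconu-Renault system on a metric space $(X,d)$, let $Y_1,\dots,Y_k$ be open invariant subsets of $X$, and let $(Y_i,\sigma|_{Y_i})$ be the restriction systems, $i=1,\dots,k$, such that the (not necessarily disjoint) union $\bigcup_{i=1}^kY_i$ is $X$. Then: 1. $h_d(\sigma)\geq\max_{1\leq i\leq k}h_d(\sigma|_{Y_i})$. 2. If each $Y_i$ is closed, then $h_d(\sigma)=\max_{1\leq i\leq k}h_d(\sigma|_{Y_i})$. 3. If $Y_i\cap Y_j=\emptyset$ for all $i\neq j$, then $h_d(\sigma)=\max_{1\leq i\leq k}h_d(\sigma|_{Y_i})$.
   Context: $\mathbb N=\{1,2,\dots\}$. A Deaconu-Renault system is a pair $(X,\sigma)$ with $X$ a locally compact Hausdorff space and $\sigma:Dom(\sigma)\to Im(\sigma)$ a local homeomorphism from an open set $Dom(\sigma)\subseteq X$ onto an open set $Im(\sigma)\subseteq X$. Put $Dom(\sigma^0)=X$, $\sigma^0=\mathrm{id}$, and inductively $Dom(\sigma^n)=\sigma^{-1}(Dom(\sigma^{n-1}))$, with $\sigma^n$ the $n$-fold composition, defined on $Dom(\sigma^n)$. A subset $Y\subseteq X$ is invariant if $\sigma(Dom(\sigma)\cap Y)\subseteq Y$. For $Y$ open and invariant, the restriction system $(Y,\sigma|_Y)$ has $Dom(\sigma|_Y)=Dom(\sigma)\cap Y$, and is itself a Deaconu-Renault system; $Y$ carries the restricted metric $d$. Metric entropy of $(X,\sigma)$ on a metric space $(X,d)$ (the metric inducing the topology). For $n\in\mathbb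 N$, $x\in X$ let $I_n(x)=\{i\in\{0,\dots,n-1\}:x\in Dom(\sigma^i)\}$ and $d_n(x,y)=\max_{i\in I_n(x)\cap I_n(y)}d(\sigma^i(x),\sigma^i(y))$. For $K\subseteq X$ compact, $Z\subseteq X$ and $\varepsilon>0$, a set $A\subseteq K\cap Z$ is $(n,\varepsilon,\sigma,K\cap Z)$-separated if $d_n(x,y)>\varepsilon$ for all distinct $x,y\in A$; $sep(n,\varepsilon,\sigma,K\cap Z)$ is the largest cardinality of such a set ($\infty$ if there is no finite bound). Let $ssep(n,\varepsilon,\sigma,K)=\sup_F sep(n,\varepsilon,\sigma,K\cap F)$, the supremum being over all closed subsets $F$ of $X$ with $F\subseteq Dom(\sigma^{n-1})$. Define $h_\varepsilon(\sigma,K,d)=\limsup_{n\to\infty}\frac1n\log ssep(n,\varepsilon,\sigma,K)$ (in the extended reals, $\log\infty=\infty$, and with the convention $\log 0:=0$), $h_d(\sigma,K)=\lim_{\varepsilon\to0}h_\varepsilon(\sigma,K,d)$, and the metric entropy $h_d(\sigma)=\sup_K h_d(\sigma,K)$ over all compact $K\subseteq X$. *)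

theory Defs
  imports "HOL-Analysis.Analysis"
begin

text \<open>
  The space is an abstract topology \<open>X\<close>. A partially defined map is a total function \<open>s\<close>
  together with its domain \<open>D\<close>; the values of \<open>s\<close> outside \<open>D\<close> play no role below, so the
  restriction to \<open>Y\<close> is given by \<open>subtopology X Y\<close>, \<open>D \<inter> Y\<close> and the same function \<open>s\<close>.
\<close>

definition local_homeomorphism_map ::
    "'a topology \<Rightarrow> 'b topology \<Rightarrow> ('a \<Rightarrow> 'b) \<Rightarrow> bool" where
  "local_homeomorphism_map X Y f \<longleftrightarrow>
     f ` topspace X \<subseteq> topspace Y \<and>
     (\<forall>x \<in> topspace X. \<exists>U. openin X U \<and> x \<in> U \<and> openin Y (f ` U) \<and>
        homeomorphic_map (subtopology X U) (subtopology Y (f ` U)) f)"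

definition deaconu_renault :: "'a topology \<Rightarrow> 'a set \<Rightarrow> ('a \<Rightarrow> 'a) \<Rightarrow> bool" where
  "deaconu_renault X D s \<longleftrightarrow>
     locally_compact_space X \<and> Hausdorff_space X \<and>
     openin X D \<and> openin X (s ` D) \<and>
     local_homeomorphism_map (subtopology X D) (subtopology X (s ` D)) s"

primrec pow_dom :: "'a topology \<Rightarrow> 'a set \<Rightarrow> ('a \<Rightarrow> 'a) \<Rightarrow> nat \<Rightarrow> 'a set" where
  "pow_dom X D s 0 = topspace X"
| "pow_dom X D s (Suc n) = {x \<in> D. s x \<in> pow_dom X D s n}"

definition invariant_under :: "'a set \<Rightarrow> ('a \<Rightarrow> 'a) \<Rightarrow> 'a set \<Rightarrow> bool" where
  "invariant_under D s Y \<longleftrightarrow> s ` (D \<inter> Y) \<subseteq> Y"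

lemma deaconu_renault_restriction:
  assumes dr: "deaconu_renault X D s" and Y: "openin X Y" and inv: "invariant_under D s Y"
  shows "deaconu_renault (subtopology X Y) (D \<inter> Y) s"
proof -
  from dr have lc: "locally_compact_space X" and H: "Hausdorff_space X"
    and D: "openin X D" and sD: "openin X (s ` D)"
    and lh: "local_homeomorphism_map (subtopology X D) (subtopology X (s ` D)) s"
    by (auto simp: deaconu_renault_def)
  have DX: "D \<subseteq> topspace X" and YX: "Y \<subseteq> topspace X" and sDX: "s ` D \<subseteq> topspace X"
    using D Y sD by (auto dest: openin_subset)
  have sY: "s ` (D \<inter> Y) \<subseteq> Y" using inv by (simp add: invariant_under_def)
  have local: "\<exists>U. openin X U \<and> x \<in> U \<and> U \<subseteq> D \<inter> Y \<and> openin X (s ` U) \<and>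
      homeomorphic_map (subtopology X U) (subtopology X (s ` U)) s" if x: "x \<in> D \<inter> Y" for x
  proof -
    have "x \<in> topspace (subtopology X D)" using x DX by auto
    with lh obtain U where U: "openin (subtopology X D) U" "x \<in> U"
      "openin (subtopology X (s ` D)) (s ` U)"
      and h: "homeomorphic_map (subtopology (subtopology X D) U)
                (subtopology (subtopology X (s ` D)) (s ` U)) s"
      unfolding local_homeomorphism_map_def by (elim conjE) (drule (1) bspec, elim exE conjE)
    have UX: "openin X U" "U \<subseteq> D" using U(1) D by (auto simp: openin_open_subtopology)
    have sUX: "openin X (s ` U)" using U(3) sD by (auto simp: openin_open_subtopology)
    have h': "homeomorphic_map (subtopology X U) (subtopology X (s ` U)) s"
      using h UX(2) by (simp add: subtopology_subtopology Int_absorb1 image_mono)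
    have op: "openin (subtopology X U) (U \<inter> Y)"
      using UX(1) Y by (simp add: openin_open_subtopology openin_Int)
    have UV: "U \<inter> Y \<subseteq> topspace (subtopology X U)"
      using YX by auto
    have im: "openin (subtopology X (s ` U)) (s ` (U \<inter> Y))"
      using op by (simp only: homeomorphic_map_openness[OF h' UV])
    have o2: "openin X (s ` (U \<inter> Y))"
      using im sUX by (auto simp: openin_open_subtopology)
    have "homeomorphic_map (subtopology (subtopology X U) (U \<inter> Y))
            (subtopology (subtopology X (s ` U)) (s ` (U \<inter> Y))) s"
    proof (rule homeomorphic_map_subtopologies_alt[OF h'])
      fix x assume "x \<in> topspace (subtopology X U)" "s x \<in> topspace (subtopology X (s ` U))"
      moreover have "inj_on s (topspace (subtopology X U))"
        using h' by (rule homeomorphic_imp_injective_map)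
      ultimately show "s x \<in> s ` (U \<inter> Y) \<longleftrightarrow> x \<in> U \<inter> Y"
        using UV by (metis inj_on_image_mem_iff)
    qed
    then have "homeomorphic_map (subtopology X (U \<inter> Y)) (subtopology X (s ` (U \<inter> Y))) s"
      unfolding subtopology_subtopology
      by (simp only: Int_absorb1[OF Int_lower1] Int_absorb1[OF image_mono[OF Int_lower1]])
    moreover have "openin X (U \<inter> Y)" using UX(1) Y by (rule openin_Int)
    ultimately show ?thesis
      using UX(2) o2 U(2) x by (intro exI[of _ "U \<inter> Y"] conjI) auto
  qed
  have oDY: "openin X (D \<inter> Y)" using D Y by (rule openin_Int)
  have osDY: "openin X (s ` (D \<inter> Y))"
  proof (subst openin_subopen, intro ballI)
    fix y assume "y \<in> s ` (D \<inter> Y)"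
    then obtain x where x: "x \<in> D \<inter> Y" and y: "y = s x" by (rule imageE)
    from local[OF x] obtain U where "x \<in> U" "U \<subseteq> D \<inter> Y" "openin X (s ` U)"
      by (elim exE conjE)
    then show "\<exists>T. openin X T \<and> y \<in> T \<and> T \<subseteq> s ` (D \<inter> Y)"
      unfolding y by (intro exI[of _ "s ` U"] conjI imageI image_mono)
  qed
  show ?thesis
    unfolding deaconu_renault_def
  proof (intro conjI)
    show "locally_compact_space (subtopology X Y)"
      using lc H Y by (simp add: locally_compact_space_open_subset)
    show "Hausdorff_space (subtopology X Y)"
      using H by (rule Hausdorff_space_subtopology)
    show "openin (subtopology X Y) (D \<inter> Y)"
      using oDY Y by (simp add: openin_open_subtopology)
    show "openin (subtopology X Y) (s ` (D \<inter> Y))"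
      using osDY Y sY by (simp add: openin_open_subtopology)
    have e1: "subtopology (subtopology X Y) (D \<inter> Y) = subtopology X (D \<inter> Y)"
      by (simp add: subtopology_subtopology Int_absorb1)
    have e2: "subtopology (subtopology X Y) (s ` (D \<inter> Y)) = subtopology X (s ` (D \<inter> Y))"
      using sY by (simp add: subtopology_subtopology Int_absorb1)
    show "local_homeomorphism_map (subtopology (subtopology X Y) (D \<inter> Y))
            (subtopology (subtopology X Y) (s ` (D \<inter> Y))) s"
      unfolding e1 e2 local_homeomorphism_map_def
    proof (intro conjI ballI)
      show "s ` topspace (subtopology X (D \<inter> Y)) \<subseteq> topspace (subtopology X (s ` (D \<inter> Y)))"
        using sDX by auto
      fix x assume "x \<in> topspace (subtopology X (D \<inter> Y))"
      then have "x \<in> D \<inter> Y" by simp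
      from local[OF this] obtain U where U: "openin X U" "x \<in> U" "U \<subseteq> D \<inter> Y" "openin X (s ` U)"
        "homeomorphic_map (subtopology X U) (subtopology X (s ` U)) s" by (elim exE conjE)
      have i1: "(D \<inter> Y) \<inter> U = U" and i2: "s ` (D \<inter> Y) \<inter> s ` U = s ` U"
        using U(3) by auto
      have "openin (subtopology X (D \<inter> Y)) U"
        using U(1,3) oDY by (simp add: openin_open_subtopology)
      moreover have "openin (subtopology X (s ` (D \<inter> Y))) (s ` U)"
        using U(3,4) osDY by (simp add: openin_open_subtopology image_mono)
      ultimately show "\<exists>U. openin (subtopology X (D \<inter> Y)) U \<and> x \<in> U \<and>
          openin (subtopology X (s ` (D \<inter> Y))) (s ` U) \<and>
          homeomorphic_map (subtopology (subtopology X (D \<inter> Y)) U)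
            (subtopology (subtopology X (s ` (D \<inter> Y))) (s ` U)) s"
        using U(2,5) unfolding subtopology_subtopology
        by (intro exI[of _ U]) (simp only: i1 i2 simp_thms)
    qed
  qed
qed

definition iter_indices ::
    "'a topology \<Rightarrow> 'a set \<Rightarrow> ('a \<Rightarrow> 'a) \<Rightarrow> nat \<Rightarrow> 'a \<Rightarrow> nat set" where
  "iter_indices X D s n x = {i \<in> {..<n}. x \<in> pow_dom X D s i}"

text \<open>Only meaningful for \<open>n \<ge> 1\<close> and points of \<open>X\<close>, where the maximum is over a set containing
  the index \<open>0\<close>.\<close>

definition iter_dist ::
    "'a topology \<Rightarrow> 'a set \<Rightarrow> ('a \<Rightarrow> 'a) \<Rightarrow> ('a \<Rightarrow> 'a \<Rightarrow> real) \<Rightarrow> nat \<Rightarrow> 'a \<Rightarrow> 'a \<Rightarrow> real" where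
  "iter_dist X D s d n x y =
     Max ((\<lambda>i. d ((s ^^ i) x) ((s ^^ i) y)) ` (iter_indices X D s n x \<inter> iter_indices X D s n y))"

definition separated_set ::
    "'a topology \<Rightarrow> 'a set \<Rightarrow> ('a \<Rightarrow> 'a) \<Rightarrow> ('a \<Rightarrow> 'a \<Rightarrow> real) \<Rightarrow> nat \<Rightarrow> real \<Rightarrow> 'a set \<Rightarrow> 'a set \<Rightarrow> bool"
  where
  "separated_set X D s d n \<epsilon> B A \<longleftrightarrow>
     A \<subseteq> B \<and> (\<forall>x\<in>A. \<forall>y\<in>A. x \<noteq> y \<longrightarrow> iter_dist X D s d n x y > \<epsilon>)"

definition ecard :: "'a set \<Rightarrow> enat" where
  "ecard A = (if finite A then enat (card A) else \<infinity>)"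

definition sep ::
    "'a topology \<Rightarrow> 'a set \<Rightarrow> ('a \<Rightarrow> 'a) \<Rightarrow> ('a \<Rightarrow> 'a \<Rightarrow> real) \<Rightarrow> nat \<Rightarrow> real \<Rightarrow> 'a set \<Rightarrow> enat" where
  "sep X D s d n \<epsilon> B = (SUP A \<in> {A. separated_set X D s d n \<epsilon> B A}. ecard A)"

definition ssep ::
    "'a topology \<Rightarrow> 'a set \<Rightarrow> ('a \<Rightarrow> 'a) \<Rightarrow> ('a \<Rightarrow> 'a \<Rightarrow> real) \<Rightarrow> nat \<Rightarrow> real \<Rightarrow> 'a set \<Rightarrow> enat" where
  "ssep X D s d n \<epsilon> K =
     (SUP F \<in> {F. closedin X F \<and> F \<subseteq> pow_dom X D s (n - 1)}. sep X D s d n \<epsilon> (K \<inter> F))"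

text \<open>Logarithm with the conventions \<open>log 0 = 0\<close> and \<open>log \<infinity> = \<infinity>\<close>.\<close>

definition elog :: "enat \<Rightarrow> ereal" where
  "elog m = (case m of enat k \<Rightarrow> if k = 0 then 0 else ereal (ln (real k)) | \<infinity> \<Rightarrow> \<infinity>)"

definition entropy_eps ::
    "'a topology \<Rightarrow> 'a set \<Rightarrow> ('a \<Rightarrow> 'a) \<Rightarrow> ('a \<Rightarrow> 'a \<Rightarrow> real) \<Rightarrow> real \<Rightarrow> 'a set \<Rightarrow> ereal" where
  "entropy_eps X D s d \<epsilon> K = limsup (\<lambda>n. ereal (1 / real n) * elog (ssep X D s d n \<epsilon> K))"

definition entropy_on ::
    "'a topology \<Rightarrow> 'a set \<Rightarrow> ('a \<Rightarrow> 'a) \<Rightarrow> ('a \<Rightarrow> 'a \<Rightarrow> real) \<Rightarrow> 'a set \<Rightarrow> ereal" where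
  "entropy_on X D s d K = Lim (at_right 0) (\<lambda>\<epsilon>. entropy_eps X D s d \<epsilon> K)"

definition metric_entropy ::
    "'a topology \<Rightarrow> 'a set \<Rightarrow> ('a \<Rightarrow> 'a) \<Rightarrow> ('a \<Rightarrow> 'a \<Rightarrow> real) \<Rightarrow> ereal" where
  "metric_entropy X D s d = (SUP K \<in> {K. compactin X K}. entropy_on X D s d K)"

end

theory Submission
  imports Defs
begin

text \<open>
  For invariant \<open>Y\<close> the restricted system has the iterated distances of \<open>X\<close>, and \<open>K \<inter> F\<close> is
  compact, hence closed in \<open>X\<close>, whenever \<open>K \<subseteq> Y\<close> is compact and \<open>F\<close> is closed in \<open>Y\<close>; so every
  separated set counted in \<open>Y\<close> is counted in \<open>X\<close>. Conversely, for clopen \<open>Y\<^sub>i\<close> a separated set in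
  \<open>K\<close> is the union of \<open>k\<close> separated sets in the compact sets \<open>K \<inter> Y\<^sub>i\<close>, and the factor \<open>k\<close> this
  costs disappears in the limit of \<open>log / n\<close>. A finite disjoint open cover consists of clopen sets.
\<close>

lemma elog_mono: "a \<le> b \<Longrightarrow> elog a \<le> elog b"
  by (cases a; cases b) (auto simp: elog_def)

text \<open>Beyond \<open>ln_mult\<close>, the case \<open>m = 0\<close> rests on the convention
  \<open>elog 0 = 0\<close> and leaves only \<open>ln k \<ge> 0\<close>, which follows from
  \<open>k \<ge> 1\<close>.\<close>

lemma elog_mult_le:
  assumes "k \<ge> 1"
  shows "elog (enat k * m) \<le> ereal (ln (real k)) + elog m"
  using assms by (cases m) (auto simp: elog_def ln_mult)

lemma ecard_UN_le:
  assumes "finite I" "\<And>i. i \<in> I \<Longrightarrow> ecard (A i) \<le> m" "I \<noteq> {}"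
  shows "ecard (\<Union>i\<in>I. A i) \<le> enat (card I) * m"
proof (cases m)
  case (enat c)
  have fin: "finite (A i)" and le: "card (A i) \<le> c" if "i \<in> I" for i
    using assms(2)[OF that] enat by (auto simp: ecard_def split: if_splits)
  have "card (\<Union>i\<in>I. A i) \<le> (\<Sum>i\<in>I. card (A i))"
    using assms(1) by (rule card_UN_le)
  also have "\<dots> \<le> card I * c"
    using sum_bounded_above[of I "\<lambda>i. card (A i)" c] le by simp
  finally show ?thesis
    using enat fin assms(1) by (simp add: ecard_def)
next
  \<comment> \<open>As \<open>I\<close> is nonempty, the factor \<open>card I\<close> is positive,
    so the bound is \<open>\<infinity>\<close> and not \<open>0 * \<infinity> = 0\<close>.\<close>
  case infinity
  then show ?thesis
    using assms(1,3) by (simp add: imult_is_infinity zero_enat_def)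
qed

lemma separated_set_anti_eps:
  "separated_set X D s d n b B A \<Longrightarrow> a \<le> b \<Longrightarrow> separated_set X D s d n a B A"
  unfolding separated_set_def by fastforce

text \<open>Two systems are allowed so that the comparison serves both a change of
  \<open>\<epsilon>\<close> in one system and the passage from a restriction to
  \<open>X\<close>.\<close>

lemma entropy_eps_mono:
  assumes "\<And>n. ssep X D s d n a K \<le> ssep X' D' s' d' n b K'"
  shows "entropy_eps X D s d a K \<le> entropy_eps X' D' s' d' b K'"
  unfolding entropy_eps_def
  by (intro Limsup_mono always_eventually allI ereal_mult_left_mono elog_mono assms) simp

lemma entropy_eps_anti_eps:
  assumes "a \<le> b"
  shows "entropy_eps X D s d b K \<le> entropy_eps X D s d a K"
proof (rule entropy_eps_mono)
  fix n
  show "ssep X D s d n b K \<le> ssep X D s d n a K"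
    unfolding ssep_def sep_def using assms
    by (intro SUP_mono' SUP_subset_mono) (auto intro: separated_set_anti_eps)
qed

text \<open>A smaller \<open>\<epsilon>\<close> gives a larger entropy, so the limit at zero exists
  and is the supremum. Later estimates can then be made for one \<open>\<epsilon>\<close> at a
  time.\<close>

lemma entropy_on_eq_SUP:
  "entropy_on X D s d K = (SUP \<epsilon>\<in>{0<..}. entropy_eps X D s d \<epsilon> K)" (is "_ = ?S")
proof -
  have "((\<lambda>\<epsilon>. entropy_eps X D s d \<epsilon> K) \<longlongrightarrow> ?S) (at_right 0)"
  proof (rule order_tendstoI)
    fix a assume "a < ?S"
    then obtain b where b: "b > 0" "a < entropy_eps X D s d b K"
      by (auto simp: less_SUP_iff)
    have "\<forall>\<^sub>F \<epsilon> in at_right 0. \<epsilon> \<in> {0<..<b}"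
      using b(1) by (rule eventually_at_right_real)
    then show "\<forall>\<^sub>F \<epsilon> in at_right 0. a < entropy_eps X D s d \<epsilon> K"
    proof eventually_elim
      case (elim \<epsilon>)
      then show ?case
        using b(2) by (intro less_le_trans[OF b(2) entropy_eps_anti_eps]) simp
    qed
  next
    fix a assume a: "?S < a"
    have "entropy_eps X D s d \<epsilon> K < a" if "\<epsilon> > 0" for \<epsilon>
      using that a by (intro le_less_trans[OF SUP_upper a]) auto
    then show "\<forall>\<^sub>F \<epsilon> in at_right 0. entropy_eps X D s d \<epsilon> K < a"
      by (auto simp: eventually_at_filter)
  qed
  then show ?thesis
    unfolding entropy_on_def by (intro tendsto_Lim) auto
qed

text \<open>Invariance keeps the orbit of a point of \<open>Y\<close> inside \<open>Y\<close> as
  long as it is defined, so only the starting point has to be tested.\<close>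

lemma pow_dom_restriction:
  assumes "invariant_under D s Y"
  shows "pow_dom (subtopology X Y) (D \<inter> Y) s n = pow_dom X D s n \<inter> Y"
  using assms by (induction n) (auto simp: invariant_under_def)

text \<open>Points of \<open>Y\<close> have the same iteration indices in both systems, so the
  maxima in \<open>iter_dist\<close> run over the same sets.\<close>

lemma separated_set_restriction:
  assumes "invariant_under D s Y" "B \<subseteq> Y"
  shows "separated_set (subtopology X Y) (D \<inter> Y) s d n \<epsilon> B A \<longleftrightarrow> separated_set X D s d n \<epsilon> B A"
proof -
  have "iter_dist (subtopology X Y) (D \<inter> Y) s d n x y = iter_dist X D s d n x y"
    if "x \<in> Y" "y \<in> Y" for x y
    using that by (simp add: iter_dist_def iter_indices_def pow_dom_restriction[OF assms(1)])
  then show ?thesis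
    using assms(2) by (auto simp: separated_set_def subset_iff)
qed

lemma ssep_restriction_le:
  assumes "Hausdorff_space X" "invariant_under D s Y" "compactin (subtopology X Y) K"
  shows "ssep (subtopology X Y) (D \<inter> Y) s d n \<epsilon> K \<le> ssep X D s d n \<epsilon> K"
  unfolding ssep_def
proof (rule SUP_mono)
  fix F assume "F \<in> {F. closedin (subtopology X Y) F \<and>
                         F \<subseteq> pow_dom (subtopology X Y) (D \<inter> Y) s (n - 1)}"
  then have F: "closedin (subtopology X Y) F" "F \<subseteq> pow_dom X D s (n - 1)"
    by (auto simp: pow_dom_restriction[OF assms(2)])
  have "compactin (subtopology X Y) (K \<inter> F)"
    using assms(3) F(1) by (rule compact_Int_closedin)
  then have "closedin X (K \<inter> F)"
    using assms(1) by (intro compactin_imp_closedin) (auto simp: compactin_subtopology)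
  moreover have "K \<inter> F \<subseteq> Y"
    using assms(3) by (auto simp: compactin_subtopology)
  ultimately show "\<exists>F'\<in>{F. closedin X F \<and> F \<subseteq> pow_dom X D s (n - 1)}.
      sep (subtopology X Y) (D \<inter> Y) s d n \<epsilon> (K \<inter> F) \<le> sep X D s d n \<epsilon> (K \<inter> F')"
    \<comment> \<open>The witness \<open>K \<inter> F\<close> replaces \<open>F\<close>, which may
      fail to be closed in \<open>X\<close>; intersecting with \<open>K\<close> once more changes
      nothing.\<close>
    using F(2) by (intro bexI[of _ "K \<inter> F"])
      (auto simp: sep_def separated_set_restriction[OF assms(2)])
qed

text \<open>The same \<open>K\<close> serves in both suprema, since a compact subset of the subspace
  is compact in \<open>X\<close>.\<close>

lemma metric_entropy_restriction_le:
  assumes "Hausdorff_space X" "invariant_under D s Y"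
  shows "metric_entropy (subtopology X Y) (D \<inter> Y) s d \<le> metric_entropy X D s d"
  unfolding metric_entropy_def
proof (rule SUP_mono)
  fix K assume "K \<in> {K. compactin (subtopology X Y) K}"
  then have K: "compactin (subtopology X Y) K" by simp
  have "entropy_on (subtopology X Y) (D \<inter> Y) s d K \<le> entropy_on X D s d K"
    unfolding entropy_on_eq_SUP
    by (intro SUP_mono' entropy_eps_mono ssep_restriction_le assms K)
  then show "\<exists>K'\<in>{K. compactin X K}.
      entropy_on (subtopology X Y) (D \<inter> Y) s d K \<le> entropy_on X D s d K'"
    using K by (auto simp: compactin_subtopology)
qed

text \<open>A separated set is cut along the cover; the pieces may overlap, since only an upper
  bound for the cardinality is sought. For \<open>m\<close> the largest of the values at the
  \<open>Y i\<close> will be taken.\<close>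

lemma ssep_cover_le:
  assumes "finite I" "I \<noteq> {}"
    and inv: "\<And>i. i \<in> I \<Longrightarrow> invariant_under D s (Y i)"
    and cover: "(\<Union>i\<in>I. Y i) = topspace X"
    and m: "\<And>i. i \<in> I \<Longrightarrow> ssep (subtopology X (Y i)) (D \<inter> Y i) s d n \<epsilon> (K \<inter> Y i) \<le> m"
  shows "ssep X D s d n \<epsilon> K \<le> enat (card I) * m"
  unfolding ssep_def sep_def
proof (intro SUP_least, elim CollectE conjE)
  fix F A
  assume F: "closedin X F" "F \<subseteq> pow_dom X D s (n - 1)"
    and A: "separated_set X D s d n \<epsilon> (K \<inter> F) A"
  have "ecard (A \<inter> Y i) \<le> m" if i: "i \<in> I" for i
  proof -
    let ?X = "subtopology X (Y i)" and ?D = "D \<inter> Y i"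
    have "separated_set X D s d n \<epsilon> ((K \<inter> Y i) \<inter> (F \<inter> Y i)) (A \<inter> Y i)"
      using A by (auto simp: separated_set_def)
    then have "separated_set ?X ?D s d n \<epsilon> ((K \<inter> Y i) \<inter> (F \<inter> Y i)) (A \<inter> Y i)"
      by (subst separated_set_restriction[OF inv[OF i]]) auto
    then have "ecard (A \<inter> Y i) \<le> sep ?X ?D s d n \<epsilon> ((K \<inter> Y i) \<inter> (F \<inter> Y i))"
      unfolding sep_def by (intro SUP_upper) simp
    also have "\<dots> \<le> ssep ?X ?D s d n \<epsilon> (K \<inter> Y i)"
      unfolding ssep_def using F
      by (intro SUP_upper) (auto simp: pow_dom_restriction[OF inv[OF i]] closedin_subtopology)
    finally show ?thesis using m[OF i] by simp
  qed
  then have "ecard (\<Union>i\<in>I. A \<inter> Y i) \<le> enat (card I) * m"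
    using assms(1,2) by (intro ecard_UN_le)
  moreover have "(\<Union>i\<in>I. A \<inter> Y i) = A"
    using A closedin_subset[OF F(1)] cover by (auto simp: separated_set_def)
  ultimately show "ecard A \<le> enat (card I) * m" by simp
qed

lemma entropy_eps_cover_le:
  assumes "finite I" "I \<noteq> {}"
    and inv: "\<And>i. i \<in> I \<Longrightarrow> invariant_under D s (Y i)"
    and cover: "(\<Union>i\<in>I. Y i) = topspace X"
    and M: "\<And>i. i \<in> I \<Longrightarrow> entropy_eps (subtopology X (Y i)) (D \<inter> Y i) s d \<epsilon> (K \<inter> Y i) \<le> M"
  shows "entropy_eps X D s d \<epsilon> K \<le> M"
\<comment> \<open>A bound \<open>C\<close> strictly above \<open>M\<close> turns the limsup bounds
  into eventual ones, and finitely many of these hold simultaneously.\<close>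
proof (rule dense_ge)
  fix C assume "M < C"
  let ?a = "\<lambda>i n. ssep (subtopology X (Y i)) (D \<inter> Y i) s d n \<epsilon> (K \<inter> Y i)"
  let ?k = "card I"
  have k: "?k \<ge> 1" using assms(1,2) by (simp add: Suc_leI card_gt_0_iff)
  have "\<forall>\<^sub>F n in sequentially. ereal (1 / real n) * elog (?a i n) < C" if "i \<in> I" for i
    using M[OF that] \<open>M < C\<close> unfolding entropy_eps_def by (intro Limsup_lessD) auto
  then have "\<forall>\<^sub>F n in sequentially. \<forall>i\<in>I. ereal (1 / real n) * elog (?a i n) < C"
    using assms(1) by (simp add: eventually_ball_finite)
  then have ev: "\<forall>\<^sub>F n in sequentially.
      ereal (1 / real n) * elog (ssep X D s d n \<epsilon> K) \<le> ereal (ln ?k / real n) + C"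
  proof eventually_elim
    case (elim n)
    \<comment> \<open>The index \<open>i\<close> of the piece with the largest count depends on
      \<open>n\<close>; this is harmless because the bound \<open>C\<close> is common to all
      pieces.\<close>
    have "Max ((\<lambda>i. ?a i n) ` I) \<in> (\<lambda>i. ?a i n) ` I"
      using assms(1,2) by (intro Max_in) auto
    then obtain i where i: "i \<in> I" "Max ((\<lambda>i. ?a i n) ` I) = ?a i n"
      by (rule imageE)
    have le: "?a j n \<le> ?a i n" if "j \<in> I" for j
      unfolding i(2)[symmetric] using assms(1) that by (intro Max_ge) auto
    have "ssep X D s d n \<epsilon> K \<le> enat ?k * ?a i n"
      by (rule ssep_cover_le[OF assms(1,2) inv cover le])
    then have "elog (ssep X D s d n \<epsilon> K) \<le> ereal (ln ?k) + elog (?a i n)"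
      by (intro order_trans[OF elog_mono elog_mult_le[OF k]])
    then have "ereal (1 / real n) * elog (ssep X D s d n \<epsilon> K)
        \<le> ereal (1 / real n) * (ereal (ln ?k) + elog (?a i n))"
      by (intro ereal_mult_left_mono) auto
    \<comment> \<open>For \<open>n = 0\<close> both sides vanish, by \<open>1 / 0 = 0\<close> and
      \<open>0 * \<infinity> = 0\<close>.\<close>
    also have "\<dots> = ereal (ln ?k / real n) + ereal (1 / real n) * elog (?a i n)"
      by (cases "elog (?a i n)") (auto simp: add_divide_distrib)
    also have "\<dots> \<le> ereal (ln ?k / real n) + C"
      using elim i(1) by (intro add_left_mono) auto
    finally show ?case .
  qed
  have "(\<lambda>n. ereal (ln ?k / real n)) \<longlonglongrightarrow> ereal 0"
    using lim_const_over_n by (intro tendsto_ereal)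
  then have "(\<lambda>n. ereal (ln ?k / real n) + C) \<longlonglongrightarrow> ereal 0 + C"
    using \<open>M < C\<close> by (intro tendsto_add_ereal_general tendsto_const) auto
  then have "limsup (\<lambda>n. ereal (ln ?k / real n) + C) = C"
    by (simp add: lim_imp_Limsup)
  then show "entropy_eps X D s d \<epsilon> K \<le> C"
    unfolding entropy_eps_def using Limsup_mono[OF ev] by simp
qed

text \<open>With \<open>K\<close> and \<open>\<epsilon>\<close> fixed, the entropy of each piece is
  at most \<open>?M\<close>, so \<open>entropy_eps_cover_le\<close> applies with \<open>?M\<close>
  as the common bound.\<close>

lemma metric_entropy_closed_cover_le:
  assumes "finite I" "I \<noteq> {}"
    and inv: "\<And>i. i \<in> I \<Longrightarrow> invariant_under D s (Y i)"
    and closed: "\<And>i. i \<in> I \<Longrightarrow> closedin X (Y i)"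
    and cover: "(\<Union>i\<in>I. Y i) = topspace X"
  shows "metric_entropy X D s d \<le> Max ((\<lambda>i. metric_entropy (subtopology X (Y i)) (D \<inter> Y i) s d) ` I)"
    (is "_ \<le> ?M")
  unfolding metric_entropy_def[of X] entropy_on_eq_SUP
proof (intro SUP_least entropy_eps_cover_le[OF assms(1,2) inv cover])
  fix K and \<epsilon> :: real and i
  assume K: "K \<in> {K. compactin X K}" and \<epsilon>: "\<epsilon> \<in> {0<..}" and i: "i \<in> I"
  let ?X = "subtopology X (Y i)" and ?D = "D \<inter> Y i"
  \<comment> \<open>Here closedness of \<open>Y i\<close> enters: it makes the trace of
    \<open>K\<close> an admissible compact set for the restricted system.\<close>
  have "compactin ?X (K \<inter> Y i)"
    using K closed[OF i] by (auto simp: compactin_subtopology compact_Int_closedin)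
  then have "entropy_on ?X ?D s d (K \<inter> Y i) \<le> metric_entropy ?X ?D s d"
    unfolding metric_entropy_def by (intro SUP_upper) simp
  moreover have "entropy_eps ?X ?D s d \<epsilon> (K \<inter> Y i) \<le> entropy_on ?X ?D s d (K \<inter> Y i)"
    unfolding entropy_on_eq_SUP using \<epsilon> by (rule SUP_upper)
  moreover have "metric_entropy ?X ?D s d \<le> ?M"
    using assms(1) i by simp
  ultimately show "entropy_eps ?X ?D s d \<epsilon> (K \<inter> Y i) \<le> ?M"
    by simp
qed

text \<open>The complement of one member is the union of the others, hence open. This reduces the
  disjoint case to the closed one.\<close>

lemma closedin_of_disjoint_open_cover:
  assumes "\<And>i. i \<in> I \<Longrightarrow> openin X (Y i)" "(\<Union>i\<in>I. Y i) = topspace X"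
    and "\<And>i j. i \<in> I \<Longrightarrow> j \<in> I \<Longrightarrow> i \<noteq> j \<Longrightarrow> Y i \<inter> Y j = {}"
    and "i \<in> I"
  shows "closedin X (Y i)"
proof -
  have "topspace X - Y i = (\<Union>j\<in>I - {i}. Y j)"
    using assms(2-4) by blast
  then show ?thesis
    using assms(1) openin_subset[OF assms(1)[OF assms(4)]] by (auto simp: closedin_def)
qed

theorem proposition5p3:
  fixes X :: "'a topology" and D :: "'a set" and s :: "'a \<Rightarrow> 'a"
    and d :: "'a \<Rightarrow> 'a \<Rightarrow> real" and k :: nat and Y :: "nat \<Rightarrow> 'a set"
  assumes "deaconu_renault X D s"
    and "Metric_space (topspace X) d"
    and "Metric_space.mtopology (topspace X) d = X"
    and "k \<ge> 1"
    and "\<And>i. i \<in> {1..k} \<Longrightarrow> openin X (Y i)"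
    and "\<And>i. i \<in> {1..k} \<Longrightarrow> invariant_under D s (Y i)"
    and "(\<Union>i\<in>{1..k}. Y i) = topspace X"
  shows "metric_entropy X D s d
           \<ge> Max ((\<lambda>i. metric_entropy (subtopology X (Y i)) (D \<inter> Y i) s d) ` {1..k})
       \<and> ((\<forall>i\<in>{1..k}. closedin X (Y i)) \<longrightarrow>
           metric_entropy X D s d
             = Max ((\<lambda>i. metric_entropy (subtopology X (Y i)) (D \<inter> Y i) s d) ` {1..k}))
       \<and> ((\<forall>i\<in>{1..k}. \<forall>j\<in>{1..k}. i \<noteq> j \<longrightarrow> Y i \<inter> Y j = {}) \<longrightarrow>
           metric_entropy X D s d
             = Max ((\<lambda>i. metric_entropy (subtopology X (Y i)) (D \<inter> Y i) s d) ` {1..k}))"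
proof -
  let ?M = "Max ((\<lambda>i. metric_entropy (subtopology X (Y i)) (D \<inter> Y i) s d) ` {1..k})"
  have I: "finite {1..k}" "{1..k} \<noteq> {}"
    using assms(4) by auto
  have ge: "metric_entropy X D s d \<ge> ?M"
    using I assms(1,6) by (auto simp: deaconu_renault_def intro!: metric_entropy_restriction_le)
  have eq: "metric_entropy X D s d = ?M" if "\<forall>i\<in>{1..k}. closedin X (Y i)"
    using ge metric_entropy_closed_cover_le[OF I assms(6) _ assms(7)] that
    by (intro antisym) auto
  have "metric_entropy X D s d = ?M"
    if "\<forall>i\<in>{1..k}. \<forall>j\<in>{1..k}. i \<noteq> j \<longrightarrow> Y i \<inter> Y j = {}"
    using closedin_of_disjoint_open_cover[OF assms(5) assms(7)] that by (intro eq) blast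
  with ge eq show ?thesis by blast
qed

end
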